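(* For any odd prime $p$, any integer $\alpha\ge0$ and any integer $n\ge0$: (1) $b_{13}\!\left(4 p^{2\alpha+2}n+\frac{(8i+p)p^{2\alpha+1}-1}{2}\right)\equiv 0 \pmod 2$ for each $i=1,2,\ldots,p-1$; (2) $b_{13}\!\left(4 p^{2\alpha+1}n+\frac{(8j+1)p^{2\alpha}-1}{2}\right)\equiv 0 \pmod 2$ for every integer $j$ with $0\le j\le p-1$ and $\left(\frac{8j+1}{p}\right)=-1$.
   Context: For a positive integer $\ell$, $b_\ell(n)$ denotes the number of partitions of $n$ having no part divisible by $\ell$. $\left(\frac{a}{p}\right)$ is the Legendre symbol. *)

theory Defs
  imports "HOL-Number_Theory.Number_Theory" "HOL-Library.Multiset"
begin

definition b :: "nat \<Rightarrow> nat \<Rightarrow> nat" where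
  "b l n = card {M :: nat multiset. (\<forall>x\<in>#M. 0 < x \<and> \<not> l dvd x) \<and> sum_mset M = n}"

end

theory Submission
  imports Defs "HOL-Computational_Algebra.Computational_Algebra" "HOL-Library.Z2"
    "HOL-Library.Disjoint_Sets"
begin

text \<open>
  The function b 13 (4 * m) is odd exactly if 8 * m + 1 is a square; the arguments in the theorem
  correspond to values 8 * m + 1 that are not squares, because of the exponent of p or because of
  quadratic non-residuosity.

  Write f(k) for the product of all (1 - q^(k n)), n > 0, over the field with two elements, so that
  f(2k) = f(k)^2. Then f(13) / f(1) = f(1)^3 f(13) / f(4), where f(1)^3 is the sum of
  all q^((x^2 - 1) / 8) and f(1) the sum of all q^((y^2 - 1) / 24) (Gauss and Euler, via the finite
  identities of Shanks). The coefficient of q^(4 M) in f(1)^3 f(13) counts the solutions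
  of 3 x^2 + 13 y^2 = 16 s with s = 6 M + 1. Choosing the sign of y such that y = x + 8 k turns this
  into s = x^2 + 13 x k + 52 k^2, a form of the principal class of discriminant -39, whose
  automorphism (x, k) -> (x + 13 k, -k) has a fixed point up to sign only if s is a square.
  Hence the part of f(1)^3 f(13) with exponents divisible by 4 is f(16) = f(4)^4, and the
  generating function of b 13 (4 * m) is f(1)^3.
\<close>

section \<open>Finite forms of two theta series\<close>

lemma half_mult_Suc_add: "Suc s * (Suc s + 1) div 2 = s * (s + 1) div 2 + Suc s"
proof -
  have "Suc s * (Suc s + 1) = s * (s + 1) + Suc s * 2"
    by (simp add: algebra_simps)
  thus ?thesis
    by simp
qed

text \<open>Shanks' finite form of Euler's pentagonal number theorem. The product over
  \<open>{s..<n}\<close> is the quotient of the first \<open>n\<close> and the first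
  \<open>s\<close> factors, written without division so that any commutative ring will do. As
  \<open>n\<close> grows, only the term \<open>s = 0\<close> keeps low-order contributions.\<close>

lemma shanks_pentagonal:
  fixes q :: "'a :: comm_ring_1"
  shows "(\<Sum>s\<le>n. (-1) ^ s * (\<Prod>k\<in>{s..<n}. 1 - q ^ Suc k) * q ^ (s * n + s * (s + 1) div 2)) =
         (\<Sum>s\<in>{- int n..int n}. (-1) ^ nat \<bar>s\<bar> * q ^ nat (s * (3 * s + 1) div 2))"
proof (induction n)
  case 0
  show ?case by simp
next
  case (Suc n)
  define E where "E = (\<lambda>s::nat. s * (s + 1) div 2)"
  have E_Suc: "E (Suc s) = E s + Suc s" for s
    unfolding E_def by (rule half_mult_Suc_add)
  define Q where "Q = (\<lambda>n s::nat. \<Prod>k\<in>{s..<n}. 1 - q ^ Suc k)"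
  have Q_Suc: "Q (Suc n) s = Q n s * (1 - q ^ Suc n)" if "s \<le> n" for s
    using that unfolding Q_def by simp
  have Q_step: "Q n s = (1 - q ^ Suc s) * Q n (Suc s)" if "s < n" for s
    using that unfolding Q_def by (simp add: prod.atLeast_Suc_lessThan)
  \<comment> \<open>Summing the changes from \<open>n\<close> to \<open>Suc n\<close> termwise
    telescopes: everything cancels except one boundary term, for which \<open>Q n n = 1\<close> when
    \<open>m = n\<close>.\<close>
  have telescope: "(\<Sum>s\<le>m. (-1) ^ s * Q (Suc n) s * q ^ (s * Suc n + E s) - (-1) ^ s * Q n s * q ^ (s * n + E s))
      = (-1) ^ Suc m * Q n m * q ^ (Suc m * n + E (Suc m))" if "m \<le> n" for m
    using that
  proof (induction m)
    case 0
    show ?case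
      using Q_Suc[of 0] by (simp add: E_def algebra_simps)
  next
    case (Suc m)
    define x where "x = q ^ (Suc m * n + E (Suc m))"
    have 1: "q ^ (Suc m * Suc n + E (Suc m)) = x * q ^ Suc m"
      unfolding x_def power_add [symmetric] by (rule arg_cong[of _ _ "\<lambda>i. q ^ i"]) simp
    have 2: "q ^ (Suc (Suc m) * n + E (Suc (Suc m))) = x * q ^ Suc n * q ^ Suc m"
      unfolding x_def power_add [symmetric] E_Suc
      by (rule arg_cong[of _ _ "\<lambda>i. q ^ i"]) simp
    have "(\<Sum>s\<le>Suc m. (-1) ^ s * Q (Suc n) s * q ^ (s * Suc n + E s) - (-1) ^ s * Q n s * q ^ (s * n + E s))
      = (-1) ^ Suc m * Q n m * x + ((-1) ^ Suc m * Q (Suc n) (Suc m) * (x * q ^ Suc m) - (-1) ^ Suc m * Q n (Suc m) * x)"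
      using Suc unfolding sum.atMost_Suc 1 x_def[symmetric] by simp
    also have "\<dots> = (-1) ^ Suc (Suc m) * Q n (Suc m) * (x * q ^ Suc n * q ^ Suc m)"
      using Suc.prems by (simp only: Q_Suc Q_step[of m] Suc_le_eq) (simp add: algebra_simps)
    finally show ?case unfolding 2 .
  qed
  have ints: "{- int (Suc n)..int (Suc n)} = {- int n..int n} \<union> {- int (Suc n), int (Suc n)}"
    by auto
  have nat_half: "a = nat (z div 2)" if "2 * int a = z" for a z
    using that by auto
  have "int (2 * E (Suc n)) = int (Suc n * (Suc n + 1))"
    by (simp add: E_def)
  hence E_int: "2 * int (E (Suc n)) = int (Suc n) * (int (Suc n) + 1)"
    by (simp only: of_nat_mult of_nat_add of_nat_numeral of_nat_1)
  \<comment> \<open>The boundary term carries the pentagonal exponent of \<open>- Suc n\<close>, the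
    new top term that of \<open>Suc n\<close>; these are the two indices by which the right-hand
    range grows.\<close>
  have "2 * int (Suc n * n + E (Suc n)) = - int (Suc n) * (3 * - int (Suc n) + 1)"
    using E_int by (simp add: algebra_simps)
  hence e1: "Suc n * n + E (Suc n) = nat (- int (Suc n) * (3 * - int (Suc n) + 1) div 2)"
    by (rule nat_half)
  have "2 * int (Suc n * Suc n + E (Suc n)) = int (Suc n) * (3 * int (Suc n) + 1)"
    using E_int by (simp add: algebra_simps)
  hence e2: "Suc n * Suc n + E (Suc n) = nat (int (Suc n) * (3 * int (Suc n) + 1) div 2)"
    by (rule nat_half)
  have "(\<Sum>s\<le>Suc n. (-1) ^ s * Q (Suc n) s * q ^ (s * Suc n + E s)) =
        (\<Sum>s\<le>n. (-1) ^ s * Q n s * q ^ (s * n + E s)) +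
        (-1) ^ Suc n * q ^ (Suc n * n + E (Suc n)) + (-1) ^ Suc n * q ^ (Suc n * Suc n + E (Suc n))"
    using telescope[of n] by (simp add: Q_def sum_subtractf diff_eq_eq)
  also have "\<dots> = (\<Sum>s\<in>{- int (Suc n)..int (Suc n)}. (-1) ^ nat \<bar>s\<bar> * q ^ nat (s * (3 * s + 1) div 2))"
    unfolding ints e1 e2 using Suc.IH
    by (subst sum.union_disjoint) (auto simp: E_def Q_def simp del: of_nat_Suc)
  finally show ?case
    unfolding Q_def E_def .
qed

lemma shanks_triangular:
  fixes q :: "'a :: comm_ring_1"
  assumes r: "\<And>k. (1 - q ^ (2 * k + 1)) * r k = 1"
  shows "(\<Sum>s<n. (\<Prod>k\<in>{s..<n}. (1 - q ^ (2 * k + 2)) * r k) * q ^ (s * (2 * n + 1))) =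
         (\<Sum>s<2 * n. q ^ (s * (s + 1) div 2))"
proof (induction n)
  case 0
  show ?case by simp
next
  case (Suc n)
  define R where "R = (\<lambda>n s::nat. \<Prod>k\<in>{s..<n}. (1 - q ^ (2 * k + 2)) * r k)"
  have R_Suc: "R (Suc n) s = R n s * ((1 - q ^ (2 * n + 2)) * r n)" if "s \<le> n" for s
    using that unfolding R_def by simp
  have R_step: "R n s = (1 - q ^ (2 * s + 2)) * r s * R n (Suc s)" if "s < n" for s
    using that unfolding R_def by (simp add: prod.atLeast_Suc_lessThan)
  have telescope: "(\<Sum>s<m. R (Suc n) s * q ^ (s * (2 * Suc n + 1)) - R n s * q ^ (s * (2 * n + 1))) =
      R n m * (1 - q ^ (2 * m)) * q ^ (m * (2 * n + 1)) * r n" if "m \<le> n" for m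
    using that
  proof (induction m)
    case 0
    show ?case by simp
  next
    case (Suc m)
    define x where "x = q ^ (m * (2 * n + 1))"
    define u where "u = q ^ (2 * m)"
    define v where "v = q ^ (2 * n + 1)"
    have 1: "q ^ (m * (2 * Suc n + 1)) = x * u"
      unfolding x_def u_def power_add [symmetric] by (rule arg_cong[of _ _ "\<lambda>i. q ^ i"]) simp
    have 2: "q ^ (Suc m * (2 * n + 1)) = x * v"
      unfolding x_def v_def power_add [symmetric] by (rule arg_cong[of _ _ "\<lambda>i. q ^ i"]) simp
    have 3: "q ^ (2 * n + 2) = q * v" "q ^ (2 * m + 1) = q * u"
      by (simp_all add: u_def v_def)
    have rn: "(1 - v) * r n = 1" and rm: "(1 - q * u) * r m = 1"
      using r[of n] r[of m] by (simp_all only: 3 v_def)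
    have "(\<Sum>s<Suc m. R (Suc n) s * q ^ (s * (2 * Suc n + 1)) - R n s * q ^ (s * (2 * n + 1))) =
       R n m * (1 - u) * x * r n + (R (Suc n) m * (x * u) - R n m * x)"
      using Suc unfolding sum.lessThan_Suc 1 x_def[symmetric] u_def[symmetric] by simp
    also have "\<dots> = R n m * x * (r n * (1 - q * u * v) - 1)"
      using Suc.prems by (simp only: R_Suc 3 Suc_le_lessD less_imp_le) (simp add: algebra_simps)
    \<comment> \<open>Replacing the subtracted 1 by \<open>(1 - v) * r n\<close> makes the bracket
      factor as \<open>r n * v * (1 - q * u)\<close>; the last factor then cancels against the
      \<open>r m\<close> contained in \<open>R n m\<close>.\<close>
    also have "\<dots> = R n m * x * (r n * (1 - q * u * v) - (1 - v) * r n)"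
      by (simp only: rn)
    also have "\<dots> = R n m * x * r n * v * (1 - q * u)"
      by (simp add: algebra_simps)
    also have "\<dots> = (1 - q ^ (2 * m + 2)) * R n (Suc m) * x * r n * v * ((1 - q * u) * r m)"
      using Suc.prems by (simp add: R_step[of m] mult_ac)
    also have "\<dots> = R n (Suc m) * (1 - q ^ (2 * Suc m)) * (x * v) * r n"
      by (simp only: rm) (simp add: mult_ac)
    finally show ?case unfolding 2 .
  qed
  define y where "y = q ^ (n * (2 * n + 1))"
  define u where "u = q ^ (2 * n)"
  have rn: "(1 - q * u) * r n = 1"
    using r[of n] by (simp add: u_def)
  have 1: "q ^ (n * (2 * Suc n + 1)) = y * u"
    unfolding y_def u_def power_add [symmetric] by (rule arg_cong[of _ _ "\<lambda>i. q ^ i"]) simp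
  have 2: "q ^ (2 * n * (2 * n + 1) div 2) = y"
    unfolding y_def by (simp add: mult.assoc del: mult_Suc_right)
  have 3: "q ^ (Suc (2 * n) * (Suc (2 * n) + 1) div 2) = y * u * q"
  proof -
    have "Suc (2 * n) * (Suc (2 * n) + 1) div 2 = n * (2 * n + 1) + 2 * n + 1"
      by (subst half_mult_Suc_add) simp
    thus ?thesis
      by (simp only: y_def u_def power_add power_one_right)
  qed
  have "(\<Sum>s<Suc n. R (Suc n) s * q ^ (s * (2 * Suc n + 1))) =
     (\<Sum>s<n. R n s * q ^ (s * (2 * n + 1))) + (1 - u) * y * r n + (1 - q * q * u) * r n * (y * u)"
  proof -
    have R_nn: "R n n = 1" "R (Suc n) n = (1 - q * q * u) * r n"
      by (simp_all add: R_def u_def mult.assoc)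
    have "(\<Sum>s<n. R (Suc n) s * q ^ (s * (2 * Suc n + 1))) - (\<Sum>s<n. R n s * q ^ (s * (2 * n + 1))) =
            R n n * (1 - u) * y * r n"
      using telescope[of n] unfolding u_def y_def sum_subtractf by simp
    thus ?thesis
      unfolding sum.lessThan_Suc 1 R_nn by (simp add: algebra_simps)
  qed
  \<comment> \<open>The two extra terms add up to \<open>y * r n * (1 - (q * u)^2)\<close>, a
    difference of squares whose factor \<open>1 - q * u\<close> is inverted by
    \<open>r n\<close>.\<close>
  also have "\<dots> = (\<Sum>s<n. R n s * q ^ (s * (2 * n + 1))) + y * (1 + q * u) * ((1 - q * u) * r n)"
    by (simp add: algebra_simps)
  also have "\<dots> = (\<Sum>s<2 * n. q ^ (s * (s + 1) div 2)) + (y + y * u * q)"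
    unfolding rn Suc.IH[symmetric] R_def by (simp add: algebra_simps)
  also have "\<dots> = (\<Sum>s<2 * Suc n. q ^ (s * (s + 1) div 2))"
    using 2 3 by (simp add: add.assoc)
  finally show ?case
    unfolding R_def .
qed

section \<open>Convergence of formal power series\<close>

text \<open>Convergence means that every coefficient is eventually constant, and coefficient
  \<open>n\<close> of a product involves only the finitely many coefficients up to
  \<open>n\<close>.\<close>

lemma tendsto_mult_fps:
  fixes f g :: "'b \<Rightarrow> 'a :: comm_ring_1 fps"
  assumes "(f \<longlongrightarrow> F) \<F>" "(g \<longlongrightarrow> G) \<F>"
  shows "((\<lambda>x. f x * g x) \<longlongrightarrow> F * G) \<F>"
proof (rule tendsto_fpsI)
  fix n
  have "eventually (\<lambda>x. \<forall>i\<in>{..n}. fps_nth (f x) i = fps_nth F i) \<F>"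
       "eventually (\<lambda>x. \<forall>i\<in>{..n}. fps_nth (g x) i = fps_nth G i) \<F>"
    using assms by (simp_all add: eventually_ball_finite_distrib tendsto_fps_iff)
  thus "eventually (\<lambda>x. fps_nth (f x * g x) n = fps_nth (F * G) n) \<F>"
    by eventually_elim (auto simp: fps_mult_nth intro!: sum.cong)
qed

lemma tendsto_compose_X_power_fps:
  fixes f :: "'b \<Rightarrow> 'a :: comm_ring_1 fps"
  assumes "(f \<longlongrightarrow> F) \<F>"
  shows "((\<lambda>x. f x oo fps_X ^ d) \<longlongrightarrow> F oo fps_X ^ d) \<F>"
  using assms by (auto simp: tendsto_fps_iff fps_nth_compose_X_power)

text \<open>A factor that is a series in \<open>X^d\<close> passes through the extraction of
  exponents divisible by \<open>d\<close>: such an exponent can only arise from exponents of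
  \<open>f\<close> that are themselves divisible by \<open>d\<close>.\<close>

lemma fps_nth_mult_compose_X_power:
  fixes f g :: "'a :: comm_ring_1 fps"
  assumes "d > 0"
  shows "fps_nth (f * (g oo fps_X ^ d)) (d * n) = fps_nth (Abs_fps (\<lambda>k. fps_nth f (d * k)) * g) n"
proof -
  have "fps_nth (f * (g oo fps_X ^ d)) (d * n) =
        (\<Sum>i\<in>{0..d * n}. fps_nth f i * (if d dvd d * n - i then fps_nth g ((d * n - i) div d) else 0))"
    by (simp add: fps_mult_nth fps_nth_compose_X_power)
  also have "\<dots> = (\<Sum>i\<in>(*) d ` {0..n}. fps_nth f i * (if d dvd d * n - i then fps_nth g ((d * n - i) div d) else 0))"
  proof (rule sum.mono_neutral_right, simp, use assms in force, safe)
    fix i assume i: "i \<in> {0..d * n}" "i \<notin> (*) d ` {0..n}"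
    have "\<not> d dvd d * n - i"
    proof
      assume "d dvd d * n - i"
      hence "d dvd i"
        using i by (metis atLeastAtMost_iff dvd_diffD1 dvd_triv_left)
      then obtain k where "i = d * k" ..
      with i assms show False by auto
    qed
    thus "fps_nth f i * (if d dvd d * n - i then fps_nth g ((d * n - i) div d) else 0) = 0"
      by simp
  qed
  also have "\<dots> = (\<Sum>k\<in>{0..n}. fps_nth f (d * k) * fps_nth g (n - k))"
    using assms by (subst sum.reindex) (auto simp: inj_on_def simp flip: diff_mult_distrib2)
  finally show ?thesis
    by (simp add: fps_mult_nth)
qed

section \<open>Generating functions of partitions\<close>

definition partitions_into :: "nat set \<Rightarrow> nat \<Rightarrow> nat multiset set" where
  "partitions_into A n = {M. set_mset M \<subseteq> A \<and> sum_mset M = n}"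

text \<open>Either \<open>k\<close> is not a part, or one copy of it can be removed. The guard
  \<open>k \<le> n\<close> keeps the natural subtraction exact.\<close>

lemma partitions_into_insert:
  "partitions_into (insert k A) n =
     partitions_into A n \<union> (if k \<le> n then add_mset k ` partitions_into (insert k A) (n - k) else {})"
proof (intro equalityI subsetI)
  fix M assume M: "M \<in> partitions_into (insert k A) n"
  show "M \<in> partitions_into A n \<union>
          (if k \<le> n then add_mset k ` partitions_into (insert k A) (n - k) else {})"
  proof (cases "k \<in># M")
    case True
    then obtain N where "M = add_mset k N"
      by (metis multi_member_split)
    with M show ?thesis
      by (auto simp: partitions_into_def)
  qed (use M in \<open>auto simp: partitions_into_def\<close>)
qed (auto simp: partitions_into_def split: if_splits)

lemma finite_partitions_into:
  assumes "finite A" "0 \<notin> A"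
  shows "finite (partitions_into A n)"
  using assms
proof (induction A arbitrary: n rule: finite_induct)
  case empty
  have "partitions_into {} n \<subseteq> {{#}}"
    by (auto simp: partitions_into_def)
  thus ?case
    using finite_subset by blast
next
  case (insert k A)
  show ?case
  proof (induction n rule: less_induct)
    case (less n)
    show ?case
      using insert less[of "n - k"] by (subst partitions_into_insert) auto
  qed
qed

text \<open>Induction on the set of parts: the recurrence for an added part \<open>k\<close> says
  that multiplying by \<open>1 - X^k\<close> removes \<open>k\<close> from the allowed
  parts.\<close>

lemma partitions_into_gf:
  assumes "finite A" "0 \<notin> A"
  shows "Abs_fps (\<lambda>n. of_nat (card (partitions_into A n))) * (\<Prod>k\<in>A. 1 - fps_X ^ k) =
           (1 :: 'a :: comm_ring_1 fps)"
  using assms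
proof (induction A rule: finite_induct)
  case empty
  have "partitions_into {} n = (if n = 0 then {{#}} else {})" for n
    by (auto simp: partitions_into_def)
  thus ?case
    by (auto simp: fps_eq_iff)
next
  case (insert k A)
  define C :: "nat set \<Rightarrow> 'a fps"
    where "C = (\<lambda>A. Abs_fps (\<lambda>n. of_nat (card (partitions_into A n))))"
  have rec: "card (partitions_into (insert k A) n) = card (partitions_into A n) +
          (if k \<le> n then card (partitions_into (insert k A) (n - k)) else 0)" for n
  proof (subst partitions_into_insert, subst card_Un_disjoint)
    show "finite (partitions_into A n)"
      using insert by (intro finite_partitions_into) auto
    show "finite (if k \<le> n then add_mset k ` partitions_into (insert k A) (n - k) else {})"
      using insert by (auto intro!: finite_imageI finite_partitions_into)
    have "M \<notin> partitions_into A n" if "k \<in># M" for M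
      using that insert.hyps by (auto simp: partitions_into_def)
    thus "partitions_into A n \<inter>
            (if k \<le> n then add_mset k ` partitions_into (insert k A) (n - k) else {}) = {}"
      by auto
  qed (auto simp: card_image inj_on_def)
  have "C (insert k A) * (1 - fps_X ^ k) = C A"
  proof (rule fps_ext)
    fix n
    show "fps_nth (C (insert k A) * (1 - fps_X ^ k)) n = fps_nth (C A) n"
      using arg_cong[OF rec[of n], of "of_nat :: nat \<Rightarrow> 'a"]
      by (simp add: C_def right_diff_distrib fps_X_power_mult_right_nth split: if_splits)
  qed
  moreover have "C A * (\<Prod>k\<in>A. 1 - fps_X ^ k) = 1"
    using insert by (simp add: C_def)
  ultimately have "C (insert k A) * (\<Prod>k\<in>insert k A. 1 - fps_X ^ k) = 1"
    using insert.hyps by (simp flip: mult.assoc)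
  thus ?case
    by (simp only: C_def)
qed

text \<open>No part exceeds the sum, so a finite set of parts suffices and the finite generating
  function applies.\<close>

lemma regular_partitions_eq_partitions_into:
  assumes "n \<le> N"
  shows "b l n = card (partitions_into {k\<in>{0<..N}. \<not> l dvd k} n)"
proof -
  have "x \<le> N" if "x \<in># M" "sum_mset M = n" for x M
    using that assms by (metis multi_member_split sum_mset.add_mset le_add1 le_trans)
  thus ?thesis
    unfolding b_def partitions_into_def by (intro arg_cong[of _ _ card]) auto
qed

text \<open>Parts are cut off at \<open>l * n\<close>, where the multiples of \<open>l\<close> are
  exactly \<open>l\<close> times \<open>1, ..., n\<close>. The regular parts cancel against the
  partition series, and the remaining factors form the \<open>n\<close>-th partial product in
  \<open>X^l\<close>; then \<open>n\<close> tends to infinity.\<close>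

lemma regular_partitions_gf:
  fixes \<Phi> :: "'a :: idom fps"
  assumes \<Phi>: "(\<lambda>n. \<Prod>k<n. 1 - fps_X ^ Suc k) \<longlonglongrightarrow> \<Phi>" and l: "l > 0"
  shows "Abs_fps (\<lambda>n. of_nat (b l n)) * \<Phi> = \<Phi> oo fps_X ^ l"
proof -
  define C :: "nat \<Rightarrow> 'a fps"
    where "C = (\<lambda>N. Abs_fps (\<lambda>n. of_nat (card (partitions_into {k\<in>{0<..N}. \<not> l dvd k} n))))"
  have C_lim: "(\<lambda>n. C (l * n)) \<longlonglongrightarrow> Abs_fps (\<lambda>n. of_nat (b l n))"
  proof (rule tendsto_fpsI)
    fix n
    show "eventually (\<lambda>x. fps_nth (C (l * x)) n = fps_nth (Abs_fps (\<lambda>n. of_nat (b l n))) n) sequentially"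
      using eventually_ge_at_top[of n]
    proof eventually_elim
      case (elim x)
      have "n * 1 \<le> x * l"
        using elim l by (intro mult_le_mono) auto
      hence "n \<le> l * x"
        by (simp add: mult.commute)
      thus ?case
        by (simp add: C_def regular_partitions_eq_partitions_into[of n "l * x"])
    qed
  qed
  have "C (l * n) * (\<Prod>k<l * n. 1 - fps_X ^ Suc k) = (\<Prod>k<n. 1 - fps_X ^ Suc k) oo fps_X ^ l" for n
  proof -
    have "(\<Prod>k<l * n. 1 - fps_X ^ Suc k) = (\<Prod>k\<in>{0<..l * n}. 1 - fps_X ^ k :: 'a fps)"
      by (rule prod.reindex_bij_witness[of _ "\<lambda>k. k - 1" Suc]) auto
    also have "{0<..l * n} = {k\<in>{0<..l * n}. \<not> l dvd k} \<union> (\<lambda>k. l * Suc k) ` {..<n}"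
    proof (intro equalityI subsetI)
      fix k assume k: "k \<in> {0<..l * n}"
      show "k \<in> {k\<in>{0<..l * n}. \<not> l dvd k} \<union> (\<lambda>k. l * Suc k) ` {..<n}"
      proof (cases "l dvd k")
        case True
        then obtain j where "k = l * j" ..
        with k l show ?thesis
          by (intro UnI2 image_eqI[of _ _ "j - 1"]) auto
      qed (use k in auto)
    qed (use l in \<open>auto simp del: mult_Suc_right\<close>)
    also have "(\<Prod>k\<in>\<dots>. 1 - fps_X ^ k :: 'a fps) =
                 (\<Prod>k\<in>{k\<in>{0<..l * n}. \<not> l dvd k}. 1 - fps_X ^ k) * (\<Prod>k<n. 1 - fps_X ^ (l * Suc k))"
      using l by (subst prod.union_disjoint, simp, simp, force, subst prod.reindex) (auto simp: inj_on_def)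
    also have "C (l * n) * \<dots> = (\<Prod>k<n. 1 - fps_X ^ (l * Suc k))"
      using partitions_into_gf[of "{k\<in>{0<..l * n}. \<not> l dvd k}", where ?'a = 'a]
      by (simp add: C_def flip: mult.assoc)
    also have "\<dots> = (\<Prod>k<n. 1 - fps_X ^ Suc k) oo fps_X ^ l"
      using l by (simp add: fps_compose_prod_distrib fps_compose_sub_distrib fps_X_power_compose
          power_mult zero_power del: power_Suc mult_Suc_right)
    finally show ?thesis .
  qed
  moreover have "(\<lambda>n. C (l * n) * (\<Prod>k<l * n. 1 - fps_X ^ Suc k)) \<longlonglongrightarrow> Abs_fps (\<lambda>n. of_nat (b l n)) * \<Phi>"
    using l by (intro tendsto_mult_fps C_lim filterlim_compose[OF \<Phi>])
      (auto intro!: filterlim_subseq simp: strict_mono_def)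
  ultimately show ?thesis
    using tendsto_compose_X_power_fps[OF \<Phi>, of l] by (simp add: LIMSEQ_unique)
qed

section \<open>The theta series modulo 2\<close>

text \<open>Euler's product modulo 2: \<open>24 n + 1\<close> is a square exactly for the
  generalized pentagonal numbers \<open>n = s (3 s + 1) / 2\<close>, with root
  \<open>6 s + 1\<close> up to sign. The square condition is what the quadratic form count
  needs.\<close>

definition pentagonal_fps :: "bit fps" where
  "pentagonal_fps = Abs_fps (\<lambda>n. of_bool (\<exists>y::int. y\<^sup>2 = 24 * int n + 1))"

text \<open>Gauss's series modulo 2: \<open>8 n + 1\<close> is a square exactly for the triangular
  numbers \<open>n = s (s + 1) / 2\<close>, with root \<open>2 s + 1\<close> up to sign.\<close>

definition triangular_fps :: "bit fps" where
  "triangular_fps = Abs_fps (\<lambda>n. of_bool (\<exists>x::int. x\<^sup>2 = 8 * int n + 1))"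

lemma sum_of_bool_le_one_bit:
  assumes "finite A" "\<And>x y. x \<in> A \<Longrightarrow> y \<in> A \<Longrightarrow> P x \<Longrightarrow> P y \<Longrightarrow> x = y"
  shows "(\<Sum>x\<in>A. of_bool (P x)) = (of_bool (\<exists>x\<in>A. P x) :: bit)"
proof (cases "\<exists>x\<in>A. P x")
  case True
  then obtain a where a: "a \<in> A" "P a" by blast
  have "(\<Sum>x\<in>A. of_bool (P x)) = (\<Sum>x\<in>{a}. (of_bool (P x) :: bit))"
    using a assms by (intro sum.mono_neutral_right) auto
  thus ?thesis
    using a True by simp
qed auto

lemma abs_le_square_int: "\<bar>z\<bar> \<le> z\<^sup>2" for z :: int
proof (cases "z = 0")
  case False
  hence "\<bar>z\<bar> * 1 \<le> \<bar>z\<bar> * \<bar>z\<bar>"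
    by (intro mult_left_mono) auto
  thus ?thesis
    by (simp add: power2_eq_square)
qed auto

text \<open>Below degree \<open>n\<close>, the left side of the finite identity reduces to its term
  \<open>s = 0\<close>, the partial product; the right side has each pentagonal exponent
  once.\<close>

lemma pentagonal_fps_limit: "(\<lambda>n. \<Prod>k<n. 1 - fps_X ^ Suc k) \<longlonglongrightarrow> pentagonal_fps"
proof (rule tendsto_fpsI)
  fix d :: nat
  show "eventually (\<lambda>n. fps_nth (\<Prod>k<n. 1 - fps_X ^ Suc k) d = fps_nth pentagonal_fps d) sequentially"
    using eventually_gt_at_top[of d]
  proof eventually_elim
    case (elim n)
    define P where "P = (\<lambda>s. \<Prod>k\<in>{s..<n}. 1 - fps_X ^ Suc k :: bit fps)"
    define E where "E = (\<lambda>s::int. s * (3 * s + 1) div 2)"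
    have E: "24 * E s + 1 = (6 * s + 1)\<^sup>2" for s
    proof -
      have "even (s * (3 * s + 1))" by auto
      hence "2 * E s = s * (3 * s + 1)" by (simp add: E_def)
      hence "24 * E s + 1 = 12 * (s * (3 * s + 1)) + 1" by simp
      thus ?thesis by (simp add: power2_eq_square algebra_simps)
    qed
    have E_nonneg: "E s \<ge> 0" for s
      using E[of s] zero_le_power2[of "6 * s + 1"] by linarith
    have minus_one: "(-1) ^ k = (1 :: bit fps)" for k
    proof -
      have "(-1 :: bit fps) = 1" by (simp add: fps_eq_iff)
      thus ?thesis by (metis power_one)
    qed
    have "(\<Sum>s\<le>n. P s * fps_X ^ (s * n + s * (s + 1) div 2)) = (\<Sum>s\<in>{- int n..int n}. fps_X ^ nat (E s))"
      using shanks_pentagonal[where n = n and q = "fps_X :: bit fps"] unfolding P_def E_def minus_one mult_1 .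
    hence "fps_nth (\<Sum>s\<le>n. P s * fps_X ^ (s * n + s * (s + 1) div 2)) d =
           (\<Sum>s\<in>{- int n..int n}. of_bool (E s = int d))"
      using E_nonneg by (simp only: fps_sum_nth fps_X_power_nth) (intro sum.cong, auto)
    also have "\<dots> = of_bool (\<exists>s\<in>{- int n..int n}. E s = int d)"
    proof (rule sum_of_bool_le_one_bit)
      fix s t assume "E s = int d" "E t = int d"
      hence "(6 * s + 1)\<^sup>2 = (6 * t + 1)\<^sup>2"
        using E[of s] E[of t] by simp
      hence "6 * s + 1 = 6 * t + 1 \<or> 6 * s + 1 = - (6 * t + 1)"
        by (simp only: power2_eq_iff)
      \<comment> \<open>The case of opposite signs is impossible, since \<open>6 * s + 1\<close> and
        \<open>- (6 * t + 1)\<close> differ modulo 6.\<close>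
      thus "s = t" by presburger
    qed auto
    also have "(\<exists>s\<in>{- int n..int n}. E s = int d) \<longleftrightarrow> (\<exists>y::int. y\<^sup>2 = 24 * int d + 1)"
    proof
      assume "\<exists>s\<in>{- int n..int n}. E s = int d"
      thus "\<exists>y::int. y\<^sup>2 = 24 * int d + 1"
        using E by metis
    next
      assume "\<exists>y::int. y\<^sup>2 = 24 * int d + 1"
      then obtain y :: int where y: "y\<^sup>2 = 24 * int d + 1" ..
      \<comment> \<open>\<open>y\<close> is prime to 6, so one of \<open>y\<close> and
        \<open>- y\<close> has the form \<open>6 * s + 1\<close>.\<close>
      have "y mod 6 = 1 \<or> y mod 6 = 5"
      proof -
        have "y\<^sup>2 mod 6 = 1"
          unfolding y by presburger
        hence "(y mod 6)\<^sup>2 mod 6 = 1"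
          by (simp add: power_mod)
        moreover have "y mod 6 \<in> {0, 1, 2, 3, 4, 5}"
          by auto
        ultimately show ?thesis by auto
      qed
      then obtain s where s: "y = 6 * s + 1 \<or> y = - (6 * s + 1)"
      proof
        assume "y mod 6 = 1"
        hence "y = 6 * (y div 6) + 1" by presburger
        thus ?thesis using that by blast
      next
        assume "y mod 6 = 5"
        hence "y = - (6 * (- (y div 6) - 1) + 1)" by presburger
        thus ?thesis using that by blast
      qed
      hence "y\<^sup>2 = (6 * s + 1)\<^sup>2"
        by (metis power2_minus)
      hence Es: "E s = int d"
        using y E[of s] by simp
      \<comment> \<open>This bound places \<open>s\<close> inside the finite summation range,
        because \<open>E s = d < n\<close>.\<close>
      have "\<bar>s\<bar> \<le> E s"
      proof -
        have "24 * E s = 36 * s\<^sup>2 + 12 * s"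
          using E[of s] by (simp add: power2_eq_square algebra_simps)
        thus ?thesis
          using abs_le_square_int[of s] by linarith
      qed
      hence "s \<in> {- int n..int n}"
        using Es elim by auto
      with Es show "\<exists>s\<in>{- int n..int n}. E s = int d" by blast
    qed
    also have "fps_nth (\<Sum>s\<le>n. P s * fps_X ^ (s * n + s * (s + 1) div 2)) d = fps_nth (P 0) d"
    proof -
      have "d < s * n + s * (s + 1) div 2" if "s > 0" for s
        using that elim by (cases s) auto
      hence "fps_nth (\<Sum>s\<le>n. P s * fps_X ^ (s * n + s * (s + 1) div 2)) d = (\<Sum>s\<le>n. if s = 0 then fps_nth (P 0) d else 0)"
        unfolding fps_sum_nth by (intro sum.cong) (auto simp: fps_X_power_mult_right_nth)
      thus ?thesis by simp
    qed
    finally show ?case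
      by (simp add: P_def pentagonal_fps_def atLeast0LessThan)
  qed
qed

lemma one_minus_square_bit_fps: "(1 - x)\<^sup>2 = 1 - x\<^sup>2" for x :: "bit fps"
proof -
  have "x + x = 0" for x :: "bit fps"
  proof (rule fps_ext)
    show "fps_nth (x + x) n = fps_nth 0 n" for n
      by (cases "fps_nth x n") (simp_all only: fps_add_nth fps_zero_nth, simp_all)
  qed
  from this[of x] show ?thesis
    by (simp add: power2_eq_square algebra_simps)
qed

text \<open>In characteristic 2 squaring turns \<open>1 - x\<close> into \<open>1 - x^2\<close>.
  Applied twice to every factor of the partial products, this survives the limit.\<close>

lemma pentagonal_fps_power4: "pentagonal_fps ^ 4 = pentagonal_fps oo fps_X ^ 4"
proof -
  define P where "P = (\<lambda>n. \<Prod>k<n. 1 - fps_X ^ Suc k :: bit fps)"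
  have "P n ^ 4 = P n oo fps_X ^ 4" for n
  proof -
    have "(1 - fps_X ^ Suc k) ^ 4 = (1 - fps_X ^ Suc k :: bit fps) oo fps_X ^ 4" for k
    proof -
      have "(1 - x) ^ 4 = 1 - x ^ 4" for x :: "bit fps"
        using one_minus_square_bit_fps[of x] one_minus_square_bit_fps[of "x\<^sup>2"]
        by (metis mult_2 numeral_Bit0 power_mult)
      thus ?thesis
        by (simp add: fps_compose_sub_distrib fps_X_power_compose mult.commute flip: power_mult del: power_Suc)
    qed
    thus ?thesis
      unfolding P_def by (simp add: fps_compose_prod_distrib prod_power_distrib del: power_Suc)
  qed
  moreover have "(\<lambda>n. P n ^ 4) \<longlonglongrightarrow> pentagonal_fps ^ 4"
    unfolding power4_eq_xxxx P_def by (intro tendsto_mult_fps pentagonal_fps_limit)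
  moreover have "(\<lambda>n. P n oo fps_X ^ 4) \<longlonglongrightarrow> (pentagonal_fps oo fps_X ^ 4)"
    unfolding P_def by (intro tendsto_compose_X_power_fps pentagonal_fps_limit)
  ultimately show ?thesis
    by (simp add: LIMSEQ_unique)
qed

text \<open>As in the pentagonal case: all terms with \<open>s > 0\<close> have order above
  \<open>d\<close>, and distinct \<open>s\<close> give distinct triangular numbers.\<close>

lemma triangular_fps_limit:
  "(\<lambda>n. \<Prod>k<n. (1 - fps_X ^ (2 * k + 2)) * inverse (1 - fps_X ^ (2 * k + 1))) \<longlonglongrightarrow> triangular_fps"
proof (rule tendsto_fpsI)
  fix d :: nat
  show "eventually (\<lambda>n. fps_nth (\<Prod>k<n. (1 - fps_X ^ (2 * k + 2)) * inverse (1 - fps_X ^ (2 * k + 1))) d =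
          fps_nth triangular_fps d) sequentially"
    using eventually_gt_at_top[of d]
  proof eventually_elim
    case (elim n)
    define R where "R = (\<lambda>s. \<Prod>k\<in>{s..<n}. (1 - fps_X ^ (2 * k + 2)) * inverse (1 - fps_X ^ (2 * k + 1)) :: bit fps)"
    define E where "E = (\<lambda>s::nat. s * (s + 1) div 2)"
    have E: "8 * int (E s) + 1 = (2 * int s + 1)\<^sup>2" for s
    proof -
      have "2 * E s = s * (s + 1)" by (simp add: E_def)
      hence "2 * int (E s) = int s * (int s + 1)"
        by (metis of_nat_1 of_nat_add of_nat_mult of_nat_numeral)
      thus ?thesis by (simp add: power2_eq_square algebra_simps)
    qed
    have "(\<Sum>s<n. R s * fps_X ^ (s * (2 * n + 1))) = (\<Sum>s<2 * n. fps_X ^ E s)"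
      unfolding R_def E_def by (intro shanks_triangular inverse_mult_eq_1') simp
    hence "fps_nth (\<Sum>s<n. R s * fps_X ^ (s * (2 * n + 1))) d = (\<Sum>s<2 * n. of_bool (E s = d))"
      by (simp only: fps_sum_nth fps_X_power_nth) (intro sum.cong, auto)
    also have "\<dots> = of_bool (\<exists>s\<in>{..<2 * n}. E s = d)"
    proof (rule sum_of_bool_le_one_bit)
      fix s t assume "E s = d" "E t = d"
      hence "(2 * int s + 1)\<^sup>2 = (2 * int t + 1)\<^sup>2"
        using E[of s] E[of t] by simp
      thus "s = t" by (subst (asm) power2_eq_iff_nonneg) auto
    qed auto
    also have "(\<exists>s\<in>{..<2 * n}. E s = d) \<longleftrightarrow> (\<exists>x::int. x\<^sup>2 = 8 * int d + 1)"
    proof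
      assume "\<exists>s\<in>{..<2 * n}. E s = d"
      thus "\<exists>x::int. x\<^sup>2 = 8 * int d + 1"
        using E by metis
    next
      assume "\<exists>x::int. x\<^sup>2 = 8 * int d + 1"
      then obtain x :: int where x: "x\<^sup>2 = 8 * int d + 1" ..
      hence "odd (x\<^sup>2)" by simp
      hence "odd \<bar>x\<bar>" by simp
      then obtain z where z: "\<bar>x\<bar> = 2 * z + 1" ..
      define s where "s = nat z"
      have "\<bar>x\<bar> = 2 * int s + 1"
        using z by (simp add: s_def)
      hence "(2 * int s + 1)\<^sup>2 = 8 * int d + 1"
        using x by (metis power2_abs)
      hence Es: "E s = d"
        using E[of s] by simp
      have "s \<le> E s"
        by (cases s) (auto simp: E_def)
      hence "s \<in> {..<2 * n}"
        using Es elim by auto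
      with Es show "\<exists>s\<in>{..<2 * n}. E s = d" by blast
    qed
    also have "fps_nth (\<Sum>s<n. R s * fps_X ^ (s * (2 * n + 1))) d = fps_nth (R 0) d"
    proof -
      have "d < s * (2 * n + 1)" if "s > 0" for s
        using that elim by (cases s) auto
      hence "fps_nth (\<Sum>s<n. R s * fps_X ^ (s * (2 * n + 1))) d = (\<Sum>s<n. if s = 0 then fps_nth (R 0) d else 0)"
        unfolding fps_sum_nth by (intro sum.cong) (auto simp: fps_X_power_mult_right_nth)
      thus ?thesis using elim by simp
    qed
    finally show ?case
      by (simp add: R_def triangular_fps_def atLeast0LessThan)
  qed
qed

lemma pentagonal_fps_nonzero: "pentagonal_fps \<noteq> 0"
proof -
  have "fps_nth pentagonal_fps 0 = 1"
    by (auto simp: pentagonal_fps_def intro: exI[of _ 1])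
  thus ?thesis by auto
qed

text \<open>Jacobi's cube identity modulo 2. The inverses of the odd factors in \<open>R n\<close>
  cancel the odd factors of \<open>P (2 * n)\<close>; what is left is the square of the even
  factors, each of which is a square modulo 2. In the limit this gives the fourth power, and one
  factor is cancelled.\<close>

lemma triangular_fps_eq: "triangular_fps = pentagonal_fps ^ 3"
proof -
  define P where "P = (\<lambda>n. \<Prod>k<n. 1 - fps_X ^ Suc k :: bit fps)"
  define R where "R = (\<lambda>n. \<Prod>k<n. (1 - fps_X ^ (2 * k + 2)) * inverse (1 - fps_X ^ (2 * k + 1)) :: bit fps)"
  have "R n * P (2 * n) = P n ^ 4" for n
  proof (induction n)
    case 0
    show ?case by (simp add: R_def P_def)
  next
    case (Suc n)
    define u where "u = (1 - fps_X ^ (2 * n + 1) :: bit fps)"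
    have inv: "inverse u * u = 1"
      unfolding u_def by (rule inverse_mult_eq_1) simp
    have sq: "1 - fps_X ^ (2 * n + 2) = (1 - fps_X ^ Suc n :: bit fps)\<^sup>2"
      unfolding one_minus_square_bit_fps power_mult [symmetric] by (simp add: mult.commute)
    have "R (Suc n) * P (2 * Suc n) = R n * P (2 * n) * (1 - fps_X ^ (2 * n + 2))\<^sup>2 * (inverse u * u)"
      by (simp add: R_def P_def u_def power2_eq_square mult_ac)
    also have "\<dots> = P n ^ 4 * (1 - fps_X ^ Suc n) ^ 4"
      unfolding Suc.IH inv sq by (simp flip: power_mult)
    also have "\<dots> = P (Suc n) ^ 4"
      by (simp add: P_def power_mult_distrib)
    finally show ?case .
  qed
  moreover have "(\<lambda>n. P n ^ 4) \<longlonglongrightarrow> pentagonal_fps ^ 4"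
    unfolding power4_eq_xxxx P_def by (intro tendsto_mult_fps pentagonal_fps_limit)
  moreover have "(\<lambda>n. R n * P (2 * n)) \<longlonglongrightarrow> triangular_fps * pentagonal_fps"
    unfolding P_def R_def
    by (intro tendsto_mult_fps triangular_fps_limit filterlim_compose[OF pentagonal_fps_limit])
       (auto intro!: filterlim_subseq simp: strict_mono_def)
  ultimately have "triangular_fps * pentagonal_fps = pentagonal_fps ^ 4"
    by (simp add: LIMSEQ_unique)
  hence "triangular_fps * pentagonal_fps = pentagonal_fps ^ 3 * pentagonal_fps"
    by (simp add: power4_eq_xxxx power3_eq_cube)
  thus ?thesis
    using pentagonal_fps_nonzero by simp
qed

section \<open>A parity count for a quadratic form\<close>

text \<open>The form has discriminant -39 and is preserved by \<open>(x, k)\<close> to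
  \<open>(x + 13 k, -k)\<close>. Following this by a change of sign where necessary keeps
  \<open>x\<close> positive and gives an involution of \<open>A\<close>, so only its fixed points
  matter for parity.\<close>

lemma card_quadratic_form_parity:
  fixes s :: int
  assumes "odd s" "\<not> 3 dvd s"
  defines "A \<equiv> {(x, k). 0 < x \<and> x\<^sup>2 + 13 * x * k + 52 * k\<^sup>2 = s}"
  shows "finite A" and "odd (card A) \<longleftrightarrow> (\<exists>t. t\<^sup>2 = s)"
proof -
  have "A \<subseteq> {0..30 * s} \<times> {- (4 * s)..4 * s}"
  proof clarify
    fix x k assume "(x, k) \<in> A"
    hence x: "0 < x" and "x\<^sup>2 + 13 * x * k + 52 * k\<^sup>2 = s"
      by (auto simp: A_def)
    \<comment> \<open>Completing the square bounds \<open>k\<close> and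
      \<open>2 * x + 13 * k\<close>, which makes \<open>A\<close> finite.\<close>
    hence s: "(2 * x + 13 * k)\<^sup>2 + 39 * k\<^sup>2 = 4 * s"
      by (simp add: power2_eq_square algebra_simps)
    have "\<bar>k\<bar> \<le> 4 * s" "\<bar>2 * x + 13 * k\<bar> \<le> 4 * s"
      using s abs_le_square_int[of k] abs_le_square_int[of "2 * x + 13 * k"] by (smt (verit) zero_le_power2)+
    thus "x \<in> {0..30 * s} \<and> k \<in> {- (4 * s)..4 * s}"
      using x by auto
  qed
  thus fin: "finite A"
    by (rule finite_subset) auto
  define h where "h = (\<lambda>(x, k). if x + 13 * k > 0 then (x + 13 * k, - k) else (- x - 13 * k, k :: int))"
  define F where "F = {p\<in>A. h p = p}"
  have nz: "x + 13 * k \<noteq> 0" if "(x, k) \<in> A" for x k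
  proof
    assume "x + 13 * k = 0"
    hence "x = - 13 * k" by simp
    with that have "s = 2 * (26 * k\<^sup>2)"
      by (auto simp: A_def power2_eq_square)
    with assms(1) show False by simp
  qed
  have hA: "h p \<in> A" if "p \<in> A" for p
  proof -
    obtain x k where p: "p = (x, k)" by force
    show ?thesis
      using that nz[of x k] by (auto simp: p h_def A_def power2_eq_square algebra_simps)
  qed
  have hh: "h (h p) = p" if "p \<in> A" for p
    using that by (auto simp: h_def A_def split: if_splits)
  \<comment> \<open>The cardinality modulo 2 is a sum of ones in \<open>bit\<close>, and these
    cancel in pairs under the fixed-point-free involution.\<close>
  have "(\<Sum>p\<in>A - F. 1 :: bit) = 0"
    by (rule sum_involution_eq_0[where h = h]) (use hA hh in \<open>auto simp: F_def\<close>)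
  hence "even (card (A - F))"
    using even_of_nat[where ?'a = bit] by simp
  moreover have "card A = card F + card (A - F)"
    using fin card_Un_disjoint[of F "A - F"] by (auto simp: F_def Un_absorb1)
  ultimately have "odd (card A) \<longleftrightarrow> odd (card F)"
    by simp
  also have "F = {(x, 0) |x. 0 < x \<and> x\<^sup>2 = s}"
  proof (intro equalityI subsetI)
    fix p assume "p \<in> F"
    then obtain x k where p: "p = (x, k)" and xk: "(x, k) \<in> A" "h (x, k) = (x, k)"
      by (cases p) (auto simp: F_def)
    \<comment> \<open>A point fixed with change of sign has \<open>2 * x = - 13 * k\<close>, hence
      \<open>4 * s = 39 * k^2\<close>, against \<open>s\<close> being prime to 3.\<close>
    have "k = 0"
    proof (cases "x + 13 * k > 0")
      case False
      with xk have "2 * x = - 13 * k"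
        by (auto simp: h_def)
      moreover have "4 * s = (2 * x + 13 * k)\<^sup>2 + 39 * k\<^sup>2"
        using xk by (auto simp: A_def power2_eq_square algebra_simps)
      ultimately have "4 * s = 3 * (13 * k\<^sup>2)"
        by simp
      with assms(2) show ?thesis by presburger
    qed (use xk in \<open>auto simp: h_def\<close>)
    with p xk show "p \<in> {(x, 0) |x. 0 < x \<and> x\<^sup>2 = s}"
      by (auto simp: A_def)
  qed (auto simp: F_def A_def h_def)
  also have "odd (card \<dots>) \<longleftrightarrow> (\<exists>t. t\<^sup>2 = s)"
  proof (cases "\<exists>t. t\<^sup>2 = s")
    case True
    then obtain t where t: "t\<^sup>2 = s" ..
    with assms(1) have "t \<noteq> 0" by auto
    hence "{(x, 0 :: int) |x. 0 < x \<and> x\<^sup>2 = s} = {(\<bar>t\<bar>, 0)}"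
      using t by (auto simp: power2_eq_iff)
    thus ?thesis using True by simp
  next
    case False
    hence "{(x, 0 :: int) |x. 0 < x \<and> x\<^sup>2 = s} = {}" by auto
    thus ?thesis using False by simp
  qed
  finally show "odd (card A) \<longleftrightarrow> (\<exists>t. t\<^sup>2 = s)" .
qed

section \<open>The 13-regular partition function at multiples of 4\<close>

lemma odd_square_mod_8: "z\<^sup>2 mod 8 = 1" if "odd z" for z :: int
proof -
  from that obtain k where k: "z = 2 * k + 1" ..
  have "even (k * (k + 1))" by simp
  then obtain j where "k * (k + 1) = 2 * j" ..
  hence "z\<^sup>2 = 8 * j + 1"
    by (simp add: k power2_eq_square algebra_simps)
  thus ?thesis by simp
qed

text \<open>The coefficient is the parity of the number of \<open>i\<close> with
  \<open>i + 13 j = 4 M\<close>, \<open>x^2 = 8 i + 1\<close> and \<open>y^2 = 24 j + 1\<close>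
  solvable. These equations combine to \<open>3 x^2 + 13 y^2 = 16 s\<close>, and
  \<open>y = x + 8 k\<close> matches the indices with the points of \<open>A\<close>.\<close>

lemma nth_triangular_mult_pentagonal:
  "fps_nth (triangular_fps * (pentagonal_fps oo fps_X ^ 13)) (4 * M) =
     of_bool (\<exists>t::int. t\<^sup>2 = 6 * int M + 1)"
proof -
  define s where "s = 6 * int M + 1"
  define I where "I = {i\<in>{0..4 * M}. (\<exists>x::int. x\<^sup>2 = 8 * int i + 1) \<and>
      13 dvd 4 * M - i \<and> (\<exists>y::int. y\<^sup>2 = 24 * int ((4 * M - i) div 13) + 1)}"
  define A where "A = {(x, k :: int). 0 < x \<and> x\<^sup>2 + 13 * x * k + 52 * k\<^sup>2 = s}"
  have s: "odd s" "\<not> 3 dvd s"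
    unfolding s_def by presburger+
  have odd_x: "odd x" if "(x, k) \<in> A" for x k
  proof
    assume "even x"
    then obtain u where "x = 2 * u" ..
    with that have "s = 2 * (2 * u\<^sup>2 + 13 * u * k + 26 * k\<^sup>2)"
      by (auto simp: A_def power2_eq_square)
    with s show False by simp
  qed
  have "bij_betw (\<lambda>(x, k). nat ((x\<^sup>2 - 1) div 8)) A I"
    unfolding bij_betw_def
  proof
    have index: "8 * int (nat ((x\<^sup>2 - 1) div 8)) + 1 = x\<^sup>2" if "(x, k) \<in> A" for x k
    proof -
      have "x\<^sup>2 mod 8 = 1"
        using odd_x[OF that] by (rule odd_square_mod_8)
      hence "x\<^sup>2 = 8 * (x\<^sup>2 div 8) + 1"
        using mult_div_mod_eq[of 8 "x\<^sup>2"] by linarith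
      then obtain j where j: "x\<^sup>2 = 8 * j + 1" ..
      moreover have "x\<^sup>2 \<ge> 0" by simp
      hence "j \<ge> 0" using j by linarith
      ultimately show ?thesis by simp
    qed
    show "inj_on (\<lambda>(x, k). nat ((x\<^sup>2 - 1) div 8)) A"
    proof (rule inj_onI, clarify)
      fix x k x' k' assume A: "(x, k) \<in> A" "(x', k') \<in> A"
        and eq: "nat ((x\<^sup>2 - 1) div 8) = nat ((x'\<^sup>2 - 1) div 8)"
      have "x\<^sup>2 = x'\<^sup>2"
        using index[OF A(1)] index[OF A(2)] eq by simp
      hence x: "x' = x"
        using A by (subst (asm) power2_eq_iff_nonneg) (auto simp: A_def)
      have "x\<^sup>2 + 13 * x * k + 52 * k\<^sup>2 = x\<^sup>2 + 13 * x * k' + 52 * k'\<^sup>2"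
        using A by (simp add: A_def x)
      \<comment> \<open>For given \<open>x\<close> the form is quadratic in \<open>k\<close>; a
        second root would make \<open>x\<close> a multiple of 4, while \<open>x\<close> is
        odd.\<close>
      hence "(k - k') * (x + 4 * (k + k')) = 0"
        by (simp add: power2_eq_square algebra_simps)
      moreover have "x + 4 * (k + k') \<noteq> 0"
        using odd_x[OF A(1)] by presburger
      ultimately show "x = x' \<and> k = k'"
        using x by simp
    qed
    show "(\<lambda>(x, k). nat ((x\<^sup>2 - 1) div 8)) ` A = I"
    proof (intro equalityI subsetI)
      fix i assume "i \<in> (\<lambda>(x, k). nat ((x\<^sup>2 - 1) div 8)) ` A"
      then obtain x k where A: "(x, k) \<in> A" and i: "8 * int i + 1 = x\<^sup>2"
        using index by auto
      define y where "y = x + 8 * k"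
      have "odd y"
        using odd_x[OF A] by (simp add: y_def)
      hence "y \<noteq> 0" by auto
      define w where "w = y\<^sup>2 - 1"
      have "w \<ge> 0"
        using \<open>y \<noteq> 0\<close> by (simp add: w_def int_one_le_iff_zero_less)
      have "3 * x\<^sup>2 + 13 * y\<^sup>2 = 16 * s"
        using A by (auto simp: A_def y_def power2_eq_square algebra_simps)
      hence eq: "24 * (4 * int M - int i) = 13 * w"
        using i by (simp add: s_def w_def)
      hence "int i \<le> 4 * int M" using \<open>w \<ge> 0\<close> by presburger
      hence "i \<le> 4 * M" by linarith
      \<comment> \<open>Since \<open>13 * 13 - 7 * 24 = 1\<close>, divisibility of
        \<open>13 * w\<close> by 24 passes to \<open>w\<close>.\<close>
      have "w = 24 * (13 * (4 * int M - int i) - 7 * w)" using eq by simp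
      then obtain j where j: "w = 24 * j" ..
      hence "j \<ge> 0" using \<open>w \<ge> 0\<close> by linarith
      have "int (4 * M - i) = int (13 * nat j)"
        using eq j \<open>j \<ge> 0\<close> \<open>i \<le> 4 * M\<close> by (simp add: of_nat_diff)
      hence "4 * M - i = 13 * nat j" by (simp only: of_nat_eq_iff)
      hence "13 dvd 4 * M - i" "y\<^sup>2 = 24 * int ((4 * M - i) div 13) + 1"
        using j \<open>j \<ge> 0\<close> by (auto simp: w_def)
      thus "i \<in> I"
        unfolding I_def using i[symmetric] \<open>i \<le> 4 * M\<close> by auto
    next
      fix i assume "i \<in> I"
      then obtain x y :: int and j where i: "i \<le> 4 * M" and x: "x\<^sup>2 = 8 * int i + 1"
        and j: "4 * M - i = 13 * j" and y: "y\<^sup>2 = 24 * int j + 1"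
        unfolding I_def by (auto elim!: dvdE)
      have "odd (x\<^sup>2)" "odd (y\<^sup>2)"
        unfolding x y by simp_all
      hence odd: "odd \<bar>x\<bar>" "odd y"
        by simp_all
      have eq: "3 * \<bar>x\<bar>\<^sup>2 + 13 * y\<^sup>2 = 16 * s"
      proof -
        have "4 * int M - int i = 13 * int j"
          using arg_cong[OF j, of int] i by (simp add: of_nat_diff)
        thus ?thesis
          using x y by (simp add: s_def)
      qed
      \<comment> \<open>The sign of \<open>y\<close> is chosen here. The equation forces 16 to
        divide \<open>y^2 - x^2\<close>, so 4 divides \<open>(v - u) * (v + u + 1)\<close>; these
        factors have opposite parity, so 4 divides one of them.\<close>
      have "\<exists>z. z\<^sup>2 = y\<^sup>2 \<and> 8 dvd z - \<bar>x\<bar>"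
      proof -
        obtain u where u: "\<bar>x\<bar> = 2 * u + 1"
          using odd(1) by (rule oddE)
        obtain v where v: "y = 2 * v + 1"
          using odd(2) by (rule oddE)
        have "16 * s = 16 * \<bar>x\<bar>\<^sup>2 + 13 * (y\<^sup>2 - \<bar>x\<bar>\<^sup>2)"
          using eq by simp
        moreover have "y\<^sup>2 - \<bar>x\<bar>\<^sup>2 = 4 * ((v - u) * (v + u + 1))"
          by (simp add: u v power2_eq_square algebra_simps)
        ultimately have "(v - u) * (v + u + 1) = 4 * (s - \<bar>x\<bar>\<^sup>2 - 3 * ((v - u) * (v + u + 1)))"
          by simp
        hence "4 dvd (v - u) * (v + u + 1)" by (rule dvdI)
        have "4 dvd v - u \<or> 4 dvd v + u + 1"
        proof (cases "even (v - u)")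
          case True
          hence "coprime 2 (v + u + 1)" by simp
          hence "coprime (2 ^ 2) (v + u + 1)" by (subst coprime_power_left_iff) simp
          hence "coprime 4 (v + u + 1)" by simp
          thus ?thesis
            using \<open>4 dvd (v - u) * (v + u + 1)\<close> coprime_dvd_mult_left_iff by blast
        next
          case False
          hence "coprime 2 (v - u)" by simp
          hence "coprime (2 ^ 2) (v - u)" by (subst coprime_power_left_iff) simp
          hence "coprime 4 (v - u)" by simp
          thus ?thesis
            using \<open>4 dvd (v - u) * (v + u + 1)\<close> coprime_dvd_mult_right_iff by blast
        qed
        thus ?thesis
        proof
          assume "4 dvd v - u"
          hence "8 dvd y - \<bar>x\<bar>" unfolding u v by presburger
          thus ?thesis by blast
        next
          assume "4 dvd v + u + 1"
          hence "8 dvd - y - \<bar>x\<bar>" unfolding u v by presburger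
          thus ?thesis by (intro exI[of _ "- y"]) simp
        qed
      qed
      then obtain z k where z: "z\<^sup>2 = y\<^sup>2" "z - \<bar>x\<bar> = 8 * k"
        by (auto elim!: dvdE)
      hence "z = \<bar>x\<bar> + 8 * k" by simp
      hence "16 * (\<bar>x\<bar>\<^sup>2 + 13 * \<bar>x\<bar> * k + 52 * k\<^sup>2) = 3 * \<bar>x\<bar>\<^sup>2 + 13 * z\<^sup>2"
        by (simp add: power2_eq_square algebra_simps)
      hence "\<bar>x\<bar>\<^sup>2 + 13 * \<bar>x\<bar> * k + 52 * k\<^sup>2 = s"
        using eq z by simp
      moreover have "\<bar>x\<bar> > 0" using odd by auto
      ultimately have "(\<bar>x\<bar>, k) \<in> A" by (simp add: A_def)
      moreover have "i = nat ((\<bar>x\<bar>\<^sup>2 - 1) div 8)" using x by simp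
      ultimately show "i \<in> (\<lambda>(x, k). nat ((x\<^sup>2 - 1) div 8)) ` A"
        by (intro image_eqI[of _ _ "(\<bar>x\<bar>, k)"]) auto
    qed
  qed
  hence card_eq: "card A = card I"
    by (rule bij_betw_same_card)
  have "fps_nth (triangular_fps * (pentagonal_fps oo fps_X ^ 13)) (4 * M) =
          (\<Sum>i\<in>{0..4 * M}. if i \<in> I then 1 else 0)"
    unfolding fps_mult_nth fps_nth_compose_X_power
    by (intro sum.cong) (auto simp: triangular_fps_def pentagonal_fps_def I_def)
  also have "\<dots> = of_nat (card I)"
  proof -
    have "{0..4 * M} \<inter> I = I" by (auto simp: I_def)
    thus ?thesis by (simp flip: sum.inter_restrict)
  qed
  also have "\<dots> = of_bool (odd (card A))"
    unfolding card_eq by (cases "even (card I)") (auto elim!: evenE oddE)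
  also have "odd (card A) \<longleftrightarrow> (\<exists>t::int. t\<^sup>2 = 6 * int M + 1)"
    using card_quadratic_form_parity(2)[OF s] unfolding A_def s_def .
  finally show ?thesis .
qed

text \<open>Multiplying the generating function identity by \<open>pentagonal_fps ^ 3\<close> makes
  the cofactor of \<open>B\<close> a series in \<open>X^4\<close>. Extracting exponents divisible by
  4 leaves \<open>C * pentagonal_fps\<close>, which equals \<open>pentagonal_fps ^ 4\<close>, so
  \<open>C\<close> is the triangular series.\<close>

lemma odd_regular_partitions_13_iff:
  "odd (b 13 (4 * m)) \<longleftrightarrow> (\<exists>x::int. x\<^sup>2 = 8 * int m + 1)"
proof -
  define B :: "bit fps" where "B = Abs_fps (\<lambda>n. of_nat (b 13 n))"
  define C :: "bit fps" where "C = Abs_fps (\<lambda>n. fps_nth B (4 * n))"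
  have "B * pentagonal_fps ^ 4 = B * pentagonal_fps * pentagonal_fps ^ 3"
    by (simp add: power4_eq_xxxx power3_eq_cube mult_ac)
  also have "\<dots> = triangular_fps * (pentagonal_fps oo fps_X ^ 13)"
    unfolding B_def regular_partitions_gf[OF pentagonal_fps_limit, of 13, simplified] triangular_fps_eq
    by (rule mult.commute)
  finally have B: "B * (pentagonal_fps oo fps_X ^ 4) = triangular_fps * (pentagonal_fps oo fps_X ^ 13)"
    by (simp only: pentagonal_fps_power4)
  have "C * pentagonal_fps = pentagonal_fps ^ 4"
  proof (rule fps_ext)
    fix M
    have "fps_nth (C * pentagonal_fps) M = of_bool (\<exists>t::int. t\<^sup>2 = 6 * int M + 1)"
      using fps_nth_mult_compose_X_power[of 4 B pentagonal_fps M]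
      by (simp add: C_def B nth_triangular_mult_pentagonal)
    \<comment> \<open>If \<open>6 M + 1\<close> is a square, it is an odd square, hence 1 modulo 8,
      so 4 divides \<open>M\<close>; for \<open>M = 4 j\<close> it is \<open>24 j + 1\<close>, the
      pentagonal condition.\<close>
    also have "\<dots> = fps_nth (pentagonal_fps oo fps_X ^ 4) M"
    proof (cases "4 dvd M")
      case True
      then obtain j where "M = 4 * j" ..
      thus ?thesis
        by (simp add: fps_nth_compose_X_power pentagonal_fps_def)
    next
      case False
      have "t\<^sup>2 \<noteq> 6 * int M + 1" for t :: int
      proof
        assume t: "t\<^sup>2 = 6 * int M + 1"
        hence "odd (t\<^sup>2)" by simp
        hence "t\<^sup>2 mod 8 = 1"
          using odd_square_mod_8 by simp
        with t False show False by presburger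
      qed
      with False show ?thesis
        by (simp add: fps_nth_compose_X_power)
    qed
    finally show "fps_nth (C * pentagonal_fps) M = fps_nth (pentagonal_fps ^ 4) M"
      by (simp only: pentagonal_fps_power4)
  qed
  also have "\<dots> = triangular_fps * pentagonal_fps"
    by (simp add: triangular_fps_eq power4_eq_xxxx power3_eq_cube)
  finally have "C = triangular_fps"
    using pentagonal_fps_nonzero by simp
  hence "fps_nth C m = fps_nth triangular_fps m" by simp
  hence eq: "of_nat (b 13 (4 * m)) = (of_bool (\<exists>x::int. x\<^sup>2 = 8 * int m + 1) :: bit)"
    by (simp add: C_def B_def triangular_fps_def)
  have "odd (b 13 (4 * m)) \<longleftrightarrow> odd (of_nat (b 13 (4 * m)) :: bit)"
    by (simp only: even_of_nat)
  also have "\<dots> \<longleftrightarrow> (\<exists>x::int. x\<^sup>2 = 8 * int m + 1)"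
    unfolding eq by simp
  finally show ?thesis .
qed

section \<open>Non-squares from prime exponents and quadratic residues\<close>

lemma even_regular_partitions_13:
  assumes "(2 * N + 1) mod 8 = 1" "\<And>x. x\<^sup>2 \<noteq> 2 * N + 1"
  shows "even (b 13 N)"
proof -
  have "4 dvd N"
    using assms(1) by presburger
  then obtain m where N: "N = 4 * m" ..
  have "x\<^sup>2 \<noteq> 8 * int m + 1" for x :: int
  proof
    assume "x\<^sup>2 = 8 * int m + 1"
    hence "int ((nat \<bar>x\<bar>)\<^sup>2) = int (2 * N + 1)"
      by (simp add: N)
    with assms(2)[of "nat \<bar>x\<bar>"] show False
      by (simp only: of_nat_eq_iff)
  qed
  thus ?thesis
    using odd_regular_partitions_13_iff[of m] N by blast
qed

text \<open>The even power is itself a square and can be cancelled from both sides.\<close>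

lemma square_eq_even_power_mult:
  fixes p c x :: nat
  assumes "p > 0" "x\<^sup>2 = p ^ (2 * a) * c"
  obtains z where "c = z\<^sup>2"
proof -
  have "(p ^ a)\<^sup>2 dvd x\<^sup>2"
    using assms(2) by (simp add: power_mult mult.commute flip: power_mult)
  hence "p ^ a dvd x"
    by (subst (asm) pow_divides_pow_iff) auto
  then obtain z where "x = p ^ a * z" ..
  hence "(p ^ a)\<^sup>2 * c = (p ^ a)\<^sup>2 * z\<^sup>2"
    using assms(2) by (auto simp: power_mult_distrib mult.commute simp flip: power_mult)
  hence "c = z\<^sup>2"
    using assms(1) by simp
  thus ?thesis by (rule that)
qed

theorem theorem3p14:
  fixes p \<alpha> n :: nat
  assumes "prime p" and "odd p"
  shows "(\<forall>i\<in>{1..p-1}.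
           even (b 13 (4 * p^(2*\<alpha>+2) * n + ((8*i+p) * p^(2*\<alpha>+1) - 1) div 2)))
       \<and> (\<forall>j\<in>{0..p-1}. Legendre (int (8*j+1)) (int p) = -1 \<longrightarrow>
           even (b 13 (4 * p^(2*\<alpha>+1) * n + ((8*j+1) * p^(2*\<alpha>) - 1) div 2)))"
proof -
  have p0: "p > 0"
    using assms(1) by (rule prime_gt_0_nat)
  \<comment> \<open>Odd squares are 1 modulo 8; this yields \<open>2 * N + 1 = 1\<close> modulo 8 in
    both families.\<close>
  have even_pow: "p ^ (2 * a) mod 8 = 1" for a
  proof -
    have "int (p\<^sup>2 mod 8) = int 1"
      using odd_square_mod_8[of "int p"] assms(2) by (simp add: zmod_int)
    hence "(p\<^sup>2 mod 8) ^ a mod 8 = 1"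
      by (simp only: of_nat_eq_iff) simp
    thus ?thesis by (simp add: power_mod power_mult)
  qed
  show ?thesis
  proof (intro conjI ballI impI)
    fix i assume i: "i \<in> {1..p-1}"
    define c where "c = 8 * p * n + 8 * i + p"
    define N where "N = 4 * p^(2*\<alpha>+2) * n + ((8*i+p) * p^(2*\<alpha>+1) - 1) div 2"
    \<comment> \<open>Oddness makes the truncated subtraction and the halving in \<open>N\<close>
      exact.\<close>
    have "odd ((8*i+p) * p^(2*\<alpha>+1))"
      using assms(2) by simp
    hence "2 * N + 1 = 8 * p^(2*\<alpha>+2) * n + (8*i+p) * p^(2*\<alpha>+1)"
      unfolding N_def by (auto elim!: oddE)
    also have "\<dots> = p ^ (2 * \<alpha>) * (p * c)"
      by (simp add: c_def power2_eq_square algebra_simps)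
    finally have N: "2 * N + 1 = p ^ (2 * \<alpha>) * (p * c)" .
    have "2 * N + 1 = 8 * (p ^ (2 * \<alpha> + 2) * n + i * p ^ (2 * \<alpha> + 1)) + p ^ (2 * (\<alpha> + 1))"
      unfolding N c_def by (simp add: power2_eq_square algebra_simps)
    hence "(2 * N + 1) mod 8 = 1"
      using even_pow[of "\<alpha> + 1"] by (metis mod_mult_self4)
    moreover have "x\<^sup>2 \<noteq> 2 * N + 1" for x
    proof
      assume "x\<^sup>2 = 2 * N + 1"
      then obtain z where z: "p * c = z\<^sup>2"
        using N p0 square_eq_even_power_mult by metis
      \<comment> \<open>A square divisible by \<open>p\<close> is divisible by \<open>p^2\<close>,
        so \<open>p\<close> would divide \<open>c\<close>, hence \<open>8 * i\<close>, hence
        \<open>i\<close>, which lies strictly between 0 and \<open>p\<close>.\<close>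
      hence "p dvd z\<^sup>2" by (metis dvd_triv_left)
      hence "p dvd z" using assms(1) prime_dvd_power by blast
      then obtain w where "z = p * w" ..
      hence "p * c = p * (p * w\<^sup>2)"
        using z by (simp add: power2_eq_square mult_ac)
      hence "c = p * w\<^sup>2" using p0 by simp
      hence "p dvd 8 * i + (8 * p * n + p)"
        unfolding c_def by (metis dvd_triv_left add.assoc add.commute)
      hence "p dvd 8 * i"
        by (subst (asm) dvd_add_left_iff) auto
      moreover have "coprime p 8"
      proof -
        have "coprime p (2 ^ 3)" using assms(2) by (subst coprime_power_right_iff) simp
        thus ?thesis by simp
      qed
      ultimately have "p dvd i"
        by (simp add: coprime_dvd_mult_right_iff)
      with i show False
        using dvd_imp_le[of p i] p0 by auto
    qed
    ultimately show "even (b 13 N)"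
      by (rule even_regular_partitions_13)
  next
    fix j assume j: "j \<in> {0..p-1}" and L: "Legendre (int (8*j+1)) (int p) = -1"
    define c where "c = 8 * p * n + 8 * j + 1"
    define N where "N = 4 * p^(2*\<alpha>+1) * n + ((8*j+1) * p^(2*\<alpha>) - 1) div 2"
    have "odd ((8*j+1) * p^(2*\<alpha>))"
      using assms(2) by simp
    hence "2 * N + 1 = 8 * p^(2*\<alpha>+1) * n + (8*j+1) * p^(2*\<alpha>)"
      unfolding N_def by (auto elim!: oddE)
    also have "\<dots> = p ^ (2 * \<alpha>) * c"
      by (simp add: c_def algebra_simps)
    finally have N: "2 * N + 1 = p ^ (2 * \<alpha>) * c" .
    have "2 * N + 1 = 8 * (p ^ (2 * \<alpha> + 1) * n + j * p ^ (2 * \<alpha>)) + p ^ (2 * \<alpha>)"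
      unfolding N c_def by (simp add: algebra_simps)
    hence "(2 * N + 1) mod 8 = 1"
      using even_pow[of \<alpha>] by (metis mod_mult_self4)
    moreover have "x\<^sup>2 \<noteq> 2 * N + 1" for x
    proof
      assume "x\<^sup>2 = 2 * N + 1"
      then obtain z where z: "c = z\<^sup>2"
        using N p0 square_eq_even_power_mult by metis
      \<comment> \<open>\<open>c\<close> is congruent to \<open>8 * j + 1\<close> modulo
        \<open>p\<close>, so a square \<open>c\<close> would make this non-residue a
        residue.\<close>
      have "(int z)\<^sup>2 - int (8 * j + 1) = int p * (8 * int n)"
        using arg_cong[OF z, of int] by (simp add: c_def)
      hence "[(int z)\<^sup>2 = int (8 * j + 1)] (mod int p)"
        unfolding cong_iff_dvd_diff by simp
      hence "QuadRes (int p) (int (8 * j + 1))"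
        unfolding QuadRes_def by blast
      with L show False
        by (simp add: Legendre_def split: if_splits)
    qed
    ultimately show "even (b 13 N)"
      by (rule even_regular_partitions_13)
  qed
qed

end
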